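(* Let $T$ be a tree with $\ell\ge 2$ leaves and $h$ heavy edges. Then $T$ is general $2$-sparse if and only if $P(T)=\ell-h-1$.
   Context: Graphs are finite and simple. A path covering of a graph $G$ is a set of vertex-disjoint paths of $G$ (a single vertex counts as a path) containing all the vertices of $G$; the path covering number $P(G)$ is the minimum number of paths in a path covering of $G$. A leaf is a vertex of degree $1$. A vertex is heavy if its degree is greater than $2$, and light otherwise. A heavy edge is an edge both of whose endpoints are heavy vertices. A graph is general $2$-sparse if each of its heavy vertices has at least two light neighbors. *)

theory Defs
  imports "Graph_Theory.Graph_Theory"
begin

text \<open>
  A finite simple graph is a \<open>pair_graph\<close>: a finite loop-free symmetric digraph whose arcs are
  ordered pairs, so that each edge \<open>uv\<close> is represented by the two arcs \<open>(u, v)\<close> and \<open>(v, u)\<close>.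
\<close>

text \<open>
  The library's \<open>forest\<close> (hence \<open>tree\<close>) is not usable for symmetric digraphs: its cycles include
  the closed walks \<open>u, v, u\<close>, so no symmetric digraph with an edge is a forest. The cycles of an
  undirected simple graph are exactly those of length at least three.
\<close>

definition acyclic_graph :: "'a pair_pre_digraph \<Rightarrow> bool" where
  "acyclic_graph G \<longleftrightarrow> (\<nexists>p. pre_digraph.cycle (with_proj G) p \<and> length p \<ge> 3)"

definition tree_graph :: "'a pair_pre_digraph \<Rightarrow> bool" where
  "tree_graph G \<longleftrightarrow>
     pair_graph G \<and> Digraph_Component.connected (with_proj G) \<and> acyclic_graph G"

text \<open>By symmetry, the out-degree of a vertex is its number of neighbours.\<close>

definition degree :: "'a pair_pre_digraph \<Rightarrow> 'a \<Rightarrow> nat" where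
  "degree G v = out_degree (with_proj G) v"

definition leaves :: "'a pair_pre_digraph \<Rightarrow> 'a set" where
  "leaves G = {v \<in> pverts G. degree G v = 1}"

definition heavy :: "'a pair_pre_digraph \<Rightarrow> 'a \<Rightarrow> bool" where
  "heavy G v \<longleftrightarrow> v \<in> pverts G \<and> degree G v > 2"

definition light :: "'a pair_pre_digraph \<Rightarrow> 'a \<Rightarrow> bool" where
  "light G v \<longleftrightarrow> v \<in> pverts G \<and> \<not> heavy G v"

text \<open>Edges are unordered pairs here, so that the two arcs of an edge are counted once.\<close>

definition heavy_edges :: "'a pair_pre_digraph \<Rightarrow> 'a set set" where
  "heavy_edges G = {{u, v} |u v. (u, v) \<in> parcs G \<and> heavy G u \<and> heavy G v}"

definition light_neighbors :: "'a pair_pre_digraph \<Rightarrow> 'a \<Rightarrow> 'a set" where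
  "light_neighbors G v = {w. (v, w) \<in> parcs G \<and> light G w}"

definition general_2_sparse :: "'a pair_pre_digraph \<Rightarrow> bool" where
  "general_2_sparse G \<longleftrightarrow>
     (\<forall>v \<in> pverts G. heavy G v \<longrightarrow> card (light_neighbors G v) \<ge> 2)"

text \<open>
  A path is given by the nonempty list of its successive vertices. A path and its reversal are
  different lists, but as they share their vertices, a covering contains at most one of them unless
  they are equal; hence the cardinality of the set of lists is the number of paths.
\<close>

definition path_covering :: "'a pair_pre_digraph \<Rightarrow> 'a list set \<Rightarrow> bool" where
  "path_covering G C \<longleftrightarrow>
     finite C \<and> (\<forall>p \<in> C. vpath p (with_proj G)) \<and>
     (\<forall>p \<in> C. \<forall>q \<in> C. p \<noteq> q \<longrightarrow> set p \<inter> set q = {}) \<and>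
     (\<Union>p \<in> C. set p) = pverts G"

definition path_covering_number :: "'a pair_pre_digraph \<Rightarrow> nat" where
  "path_covering_number G = (LEAST k. \<exists>C. path_covering G C \<and> card C = k)"

end

theory Submission
  imports Defs
begin

text \<open>
  In a tree on \<open>n\<close> vertices an edge set \<open>F\<close> with all degrees at most two is a disjoint union of paths,
  so \<open>P(T)\<close> is \<open>n - |F|\<close> for the largest such \<open>F\<close>. Let \<open>R\<close> be the set of removed edges. A heavy
  vertex \<open>v\<close> loses at least \<open>deg v - 2\<close> edges, and these numbers add up to \<open>\<ell> - 2\<close> because the degrees
  add up to \<open>2 (n - 1)\<close>. As \<open>R\<close> contains at most \<open>h\<close> edges that are counted at both ends,
  \<open>|R| \<ge> \<ell> - 2 - h\<close>, that is, \<open>P(T) \<ge> \<ell> - h - 1\<close>. Equality forces \<open>R\<close> to contain every heavy edge and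
  to leave exactly two edges at each heavy vertex, which then lead to light neighbours; conversely, if
  every heavy vertex has two light neighbours, keeping just two such edges at it attains equality.
\<close>

section \<open>Degrees in a set of edges\<close>

definition edge_degree :: "'a set set \<Rightarrow> 'a \<Rightarrow> nat" where
  "edge_degree F v = card {e \<in> F. v \<in> e}"

lemma edge_degree_mono:
  "F \<subseteq> F' \<Longrightarrow> finite F' \<Longrightarrow> edge_degree F v \<le> edge_degree F' v"
  unfolding edge_degree_def by (auto intro!: card_mono)

lemma edge_degree_insert:
  assumes "finite F" "e \<notin> F"
  shows "edge_degree (insert e F) v = edge_degree F v + (if v \<in> e then 1 else 0)"
proof -
  have "{e' \<in> insert e F. v \<in> e'} =
      (if v \<in> e then insert e {e' \<in> F. v \<in> e'} else {e' \<in> F. v \<in> e'})"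
    by auto
  then show ?thesis using assms by (simp add: edge_degree_def)
qed

lemma edge_degree_Diff:
  assumes "finite F" "F' \<subseteq> F"
  shows "edge_degree (F - F') v + edge_degree F' v = edge_degree F v"
proof -
  have "{e \<in> F. v \<in> e} = {e \<in> F - F'. v \<in> e} \<union> {e \<in> F'. v \<in> e}"
    using assms by auto
  moreover have "finite F'" using assms finite_subset by blast
  ultimately show ?thesis
    unfolding edge_degree_def using assms by (subst card_Un_disjoint[symmetric]) auto
qed

text \<open>Double counting of the incidences between \<open>A\<close> and \<open>F\<close>. With
  \<open>A\<close> the set of heavy vertices, an edge contributes its number of heavy ends.\<close>

lemma sum_edge_degree:
  assumes "finite F" "finite A"
  shows "(\<Sum>v\<in>A. edge_degree F v) = (\<Sum>e\<in>F. card (e \<inter> A))"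
proof -
  have "(\<Sum>v\<in>A. edge_degree F v) = (\<Sum>v\<in>A. \<Sum>e\<in>{e \<in> F. v \<in> e}. 1)"
    by (simp add: edge_degree_def)
  also have "\<dots> = (\<Sum>e\<in>F. \<Sum>v\<in>{v \<in> A. v \<in> e}. 1)"
    using assms by (intro sum.swap_restrict)
  also have "\<dots> = (\<Sum>e\<in>F. card (e \<inter> A))"
    by (intro sum.cong) (auto intro!: arg_cong[where f = card])
  finally show ?thesis .
qed

text \<open>Sending \<open>w\<close> to \<open>{v, w}\<close> is a bijection from the neighbours of
  \<open>v\<close> onto the edges at \<open>v\<close>; the hypothesis rules out loops.\<close>

lemma edge_degree_eq_card_neighbours:
  assumes "\<And>e. e \<in> F \<Longrightarrow> v \<in> e \<Longrightarrow> card e = 2"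
  shows "edge_degree F v = card {w. w \<noteq> v \<and> {v, w} \<in> F}"
proof -
  have "{e \<in> F. v \<in> e} = (\<lambda>w. {v, w}) ` {w. w \<noteq> v \<and> {v, w} \<in> F}"
  proof (intro equalityI subsetI)
    fix e assume e: "e \<in> {e \<in> F. v \<in> e}"
    then obtain a b where "e = {a, b}" "a \<noteq> b" using assms[of e] by (auto simp: card_2_iff)
    with e show "e \<in> (\<lambda>w. {v, w}) ` {w. w \<noteq> v \<and> {v, w} \<in> F}"
      by (auto simp: insert_commute)
  qed auto
  moreover have "inj_on (\<lambda>w. {v, w}) {w. w \<noteq> v \<and> {v, w} \<in> F}"
    by (auto simp: inj_on_def doubleton_eq_iff)
  ultimately show ?thesis by (simp add: edge_degree_def card_image)
qed

section \<open>Paths as lists of vertices\<close>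

fun path_edges :: "'a list \<Rightarrow> 'a set set" where
  "path_edges (x # y # zs) = insert {x, y} (path_edges (y # zs))"
| "path_edges _ = {}"

lemma finite_path_edges [simp]: "finite (path_edges p)"
  by (induction p rule: path_edges.induct) auto

lemma path_edges_subset: "e \<in> path_edges p \<Longrightarrow> e \<subseteq> set p"
  by (induction p rule: path_edges.induct) auto

lemma path_edges_nonempty: "e \<in> path_edges p \<Longrightarrow> e \<noteq> {}"
  by (induction p rule: path_edges.induct) auto

lemma path_edges_append:
  "p \<noteq> [] \<Longrightarrow> q \<noteq> [] \<Longrightarrow>
    path_edges (p @ q) = insert {last p, hd q} (path_edges p \<union> path_edges q)"
proof (induction p rule: path_edges.induct)
  case ("2_2" v)
  then show ?case by (cases q) auto
qed auto

lemma path_edges_rev: "path_edges (rev p) = path_edges p"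
proof (induction p rule: path_edges.induct)
  case (1 x y zs)
  have "path_edges (rev (x # y # zs)) = path_edges (rev (y # zs) @ [x])" by simp
  also have "\<dots> = insert {last (rev (y # zs)), x} (path_edges (rev (y # zs)))"
    by (subst path_edges_append) auto
  finally show ?case using 1 by (simp add: insert_commute)
qed auto

lemma card_path_edges: "distinct p \<Longrightarrow> card (path_edges p) = length p - 1"
proof (induction p rule: path_edges.induct)
  case (1 x y zs)
  then have "{x, y} \<notin> path_edges (y # zs)" using path_edges_subset[of "{x, y}" "y # zs"] by auto
  with 1 show ?case by simp
qed auto

lemma edge_degree_path_edges_notin: "v \<notin> set p \<Longrightarrow> edge_degree (path_edges p) v = 0"
  unfolding edge_degree_def using path_edges_subset by fastforce

text \<open>The sharper bound at the head carries the induction: prepending \<open>x\<close> adds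
  one edge at the old head \<open>y\<close>, whose degree thus rises to at most 2.\<close>

lemma edge_degree_path_edges_le:
  "distinct p \<Longrightarrow> edge_degree (path_edges p) v \<le> (if p \<noteq> [] \<and> v = hd p then 1 else 2)"
proof (induction p rule: path_edges.induct)
  case (1 x y zs)
  have notin: "{x, y} \<notin> path_edges (y # zs)"
    using path_edges_subset[of "{x, y}" "y # zs"] 1(2) by auto
  have x0: "edge_degree (path_edges (y # zs)) x = 0"
    using 1(2) by (intro edge_degree_path_edges_notin) auto
  from 1 notin x0 show ?case
    by (auto simp: edge_degree_insert split: if_splits)
qed (auto simp: edge_degree_def)

lemma edge_degree_path_edges_inner:
  assumes "distinct (p @ v # q)" "p \<noteq> []" "q \<noteq> []"
  shows "edge_degree (path_edges (p @ v # q)) v \<ge> 2"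
proof -
  have "{last p, v} \<in> path_edges (p @ v # q)" "{v, hd q} \<in> path_edges (p @ v # q)"
    using assms(2,3) by (auto simp: path_edges_append neq_Nil_conv)
  moreover have "last p \<in> set p" "hd q \<in> set q" using assms by auto
  then have "last p \<noteq> hd q" using assms(1) by auto
  ultimately have "{{last p, v}, {v, hd q}} \<subseteq> {e \<in> path_edges (p @ v # q). v \<in> e}"
    and "{last p, v} \<noteq> {v, hd q}"
    by (auto simp: doubleton_eq_iff)
  then have "card {{last p, v}, {v, hd q}} \<le> edge_degree (path_edges (p @ v # q)) v"
    unfolding edge_degree_def by (intro card_mono) auto
  then show ?thesis using \<open>{last p, v} \<noteq> {v, hd q}\<close> by simp
qed

text \<open>An inner vertex already has two path edges, to its predecessor and to its successor, so
  only an end has room for another edge.\<close>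

lemma path_end_if_edge_degree_le_1:
  assumes "distinct p" "v \<in> set p" "edge_degree (path_edges p) v \<le> 1"
  shows "v = hd p \<or> v = last p"
proof -
  obtain q r where p: "p = q @ v # r" using assms(2) by (meson split_list)
  show ?thesis
  proof (rule ccontr)
    assume "\<not> ?thesis"
    then have "q \<noteq> []" "r \<noteq> []" using p by auto
    then show False using edge_degree_path_edges_inner[of q v r] assms p by auto
  qed
qed

text \<open>This serves to show that paths inside differently labelled components are
  disjoint.\<close>

lemma constant_along_path:
  assumes "path_edges p \<subseteq> F" "\<And>x y. {x, y} \<in> F \<Longrightarrow> c x = c y" "x \<in> set p" "y \<in> set p"
  shows "c x = c y"
proof -
  have "z \<in> set p \<Longrightarrow> c z = c (hd p)" for z
    using assms(1)
  proof (induction p rule: path_edges.induct)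
    case (1 a b zs)
    have "c a = c b" using 1(3) assms(2) by auto
    with 1 show ?case by auto
  qed auto
  then show ?thesis using assms(3,4) by metis
qed

text \<open>Reversal changes neither the vertices nor the edges of a path, so \<open>u\<close> can
  be made the last vertex of one list and \<open>v\<close> the first of the other before they are
  concatenated.\<close>

lemma path_join:
  assumes "distinct p" "distinct q" "p \<noteq> []" "q \<noteq> []" "set p \<inter> set q = {}"
    and u: "u = hd p \<or> u = last p" and v: "v = hd q \<or> v = last q"
  obtains r where "distinct r" "r \<noteq> []" "set r = set p \<union> set q"
    "path_edges r = insert {u, v} (path_edges p \<union> path_edges q)"
proof -
  define p' where "p' = (if u = last p then p else rev p)"
  define q' where "q' = (if v = hd q then q else rev q)"
  have "distinct (p' @ q')" "p' @ q' \<noteq> []" "set (p' @ q') = set p \<union> set q"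
    using assms by (auto simp: p'_def q'_def)
  moreover have "p' \<noteq> []" "q' \<noteq> []" "last p' = u" "hd q' = v"
    using assms by (auto simp: p'_def q'_def last_rev hd_rev)
  then have "path_edges (p' @ q') = insert {u, v} (path_edges p \<union> path_edges q)"
    by (simp add: path_edges_append) (simp add: p'_def q'_def path_edges_rev)
  ultimately show ?thesis using that by blast
qed

section \<open>Path coverings and edge sets of maximum degree two\<close>

text \<open>A cycle appears as a simple path closed by an edge between its ends. It needs three
  vertices, since a path on two vertices would be closed by its own edge.\<close>

locale acyclic_edges =
  fixes V :: "'a set" and E :: "'a set set"
  assumes finite_V: "finite V"
    and edge_subset: "e \<in> E \<Longrightarrow> e \<subseteq> V"
    and card_edge: "e \<in> E \<Longrightarrow> card e = 2"
    and no_cycle: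
      "distinct p \<Longrightarrow> length p \<ge> 3 \<Longrightarrow> path_edges p \<subseteq> E \<Longrightarrow> {hd p, last p} \<notin> E"
begin

lemma finite_E: "finite E"
  using finite_V edge_subset by (meson PowI finite_Pow_iff finite_subset subsetI)

text \<open>A path joining the ends of an edge it does not use would close up to a cycle.\<close>

lemma path_ends_not_edge:
  assumes "distinct p" "path_edges p \<subseteq> E" "p \<noteq> []" "{hd p, last p} \<in> E"
  shows "{hd p, last p} \<in> path_edges p"
proof -
  have "\<not> length p \<ge> 3" using no_cycle assms by blast
  moreover have "length p \<noteq> 1"
    using card_edge[OF assms(4)] by (auto simp: length_Suc_conv)
  ultimately have "length p = 2" using assms(3) by (cases "length p") auto
  then show ?thesis by (auto simp: numeral_2_eq_2 length_Suc_conv)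
qed

text \<open>The labelling \<open>c\<close> names the connected components of the edge set \<open>F\<close>.\<close>

lemma component_labelling:
  assumes "F \<subseteq> E"
  shows "\<exists>c :: 'a \<Rightarrow> 'a. (\<forall>x y. {x, y} \<in> F \<longrightarrow> c x = c y) \<and>
    (\<forall>x\<in>V. \<forall>y\<in>V. c x = c y \<longrightarrow>
      (\<exists>p. distinct p \<and> p \<noteq> [] \<and> hd p = x \<and> last p = y \<and> path_edges p \<subseteq> F)) \<and>
    card (c ` V) + card F = card V"
proof -
  have "finite F" using assms finite_E finite_subset by blast
  from this assms show ?thesis
  proof (induction F rule: finite_induct)
    case empty
    have "\<exists>p. distinct p \<and> p \<noteq> [] \<and> hd p = x \<and> last p = x \<and> path_edges p \<subseteq> {}" for x :: 'a
      by (rule exI[of _ "[x]"]) simp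
    then show ?case by (intro exI[of _ id]) auto
  next
    case (insert e F)
    have "F \<subseteq> E" using insert by auto
    from insert.IH[OF this] obtain c :: "'a \<Rightarrow> 'a" where c: "\<forall>x y. {x, y} \<in> F \<longrightarrow> c x = c y"
      "\<forall>x\<in>V. \<forall>y\<in>V. c x = c y \<longrightarrow>
        (\<exists>p. distinct p \<and> p \<noteq> [] \<and> hd p = x \<and> last p = y \<and> path_edges p \<subseteq> F)"
      and c3: "card (c ` V) + card F = card V"
      by (elim exE conjE)
    have c1: "c x = c y" if "{x, y} \<in> F" for x y using c(1) that by simp
    have c2: "\<exists>p. distinct p \<and> p \<noteq> [] \<and> hd p = x \<and> last p = y \<and> path_edges p \<subseteq> F"
      if "x \<in> V" "y \<in> V" "c x = c y" for x y using c(2) that by simp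
    have "card e = 2" using insert card_edge by auto
    then obtain u v where e: "e = {u, v}" "u \<noteq> v" by (auto simp: card_2_iff)
    have uv: "u \<in> V" "v \<in> V" using edge_subset[of e] insert e by auto
    have ne: "c u \<noteq> c v"
    proof
      assume "c u = c v"
      then obtain p where "distinct p" "p \<noteq> []" "hd p = u" "last p = v" "path_edges p \<subseteq> F"
        using c2 uv by blast
      then show False using path_ends_not_edge[of p] insert e by auto
    qed
    \<comment> \<open>The components of \<open>u\<close> and \<open>v\<close> are merged by renaming
      the label of \<open>u\<close>. Exactly one label disappears as one edge is added.\<close>
    define d where "d = (\<lambda>x. if c x = c u then c v else c x)"
    \<comment> \<open>Here \<open>a\<close> and \<open>b\<close> are the ends of \<open>e\<close> in
      either order, so that crossing \<open>e\<close> in both directions is covered.\<close>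
    have conn: "\<exists>r. distinct r \<and> r \<noteq> [] \<and> hd r = x \<and> last r = y \<and> path_edges r \<subseteq> insert e F"
      if h: "x \<in> V" "y \<in> V" "c x = c a" "c y = c b" "{a, b} = {u, v}" "c a \<noteq> c b" for x y a b
    proof -
      have ab: "a \<in> V" "b \<in> V" using h(5) uv by (auto simp: doubleton_eq_iff)
      obtain p where p: "distinct p" "p \<noteq> []" "hd p = x" "last p = a" "path_edges p \<subseteq> F"
        using c2[of x a] h ab by auto
      obtain q where q: "distinct q" "q \<noteq> []" "hd q = b" "last q = y" "path_edges q \<subseteq> F"
        using c2[of b y] h ab by auto
      have "c z = c a" if "z \<in> set p" for z
        using constant_along_path[OF p(5) c1 that last_in_set[OF p(2)]] p(4) by simp
      moreover have "c z = c b" if "z \<in> set q" for z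
        using constant_along_path[OF q(5) c1 that hd_in_set[OF q(2)]] q(3) by simp
      ultimately have "set p \<inter> set q = {}" using h(6) by fastforce
      moreover have "path_edges (p @ q) \<subseteq> insert e F"
        using path_edges_append[OF p(2) q(2)] p(4,5) q(3,5) h(5) e(1) by auto
      ultimately show ?thesis using p(1-3) q(1,2,4)
        by (intro exI[of _ "p @ q"]) simp
    qed
    have d_path: "\<exists>p. distinct p \<and> p \<noteq> [] \<and> hd p = x \<and> last p = y \<and> path_edges p \<subseteq> insert e F"
      if xy: "x \<in> V" "y \<in> V" "d x = d y" for x y
    proof -
      consider "c x = c y" | "c x = c u" "c y = c v" | "c x = c v" "c y = c u"
        using xy(3) by (auto simp: d_def split: if_splits)
      then show ?thesis
      proof cases
        case 1
        then show ?thesis using c2[OF xy(1,2)] by blast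
      next
        case 2
        then show ?thesis using conn[OF xy(1,2)] ne by blast
      next
        case 3
        then show ?thesis using conn[OF xy(1,2)] ne by (metis insert_commute)
      qed
    qed
    have d_const: "\<forall>x y. {x, y} \<in> insert e F \<longrightarrow> d x = d y"
      using c1 e by (auto simp: d_def doubleton_eq_iff)
    have d_card: "card (d ` V) + card (insert e F) = card V"
    proof -
      have "d ` V = c ` V - {c u}" using uv ne by (auto simp: d_def image_iff)
      moreover have "c u \<in> c ` V" using uv by auto
      moreover have "card (c ` V) > 0" using uv finite_V by (auto simp: card_gt_0_iff)
      ultimately show ?thesis using c3 insert finite_V by (simp add: card_Diff_singleton)
    qed
    show ?case
      by (rule exI[of _ d]) (intro conjI d_const d_card ballI impI d_path)
  qed
qed

definition linear_cover :: "'a list set \<Rightarrow> bool" where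
  "linear_cover C \<longleftrightarrow> finite C \<and> (\<forall>p\<in>C. distinct p \<and> p \<noteq> [] \<and> path_edges p \<subseteq> E) \<and>
     (\<forall>p\<in>C. \<forall>q\<in>C. p \<noteq> q \<longrightarrow> set p \<inter> set q = {}) \<and> (\<Union>p\<in>C. set p) = V"

text \<open>Edges are added one by one to the cover by single vertices. Before \<open>e\<close> is
  added, its ends have degree at most 1, so they are ends of paths, and of two different paths by
  acyclicity. Joining these along \<open>e\<close> lowers the number of paths by one.\<close>

lemma linear_cover_of_edges:
  assumes "F \<subseteq> E" "\<And>v. v \<in> V \<Longrightarrow> edge_degree F v \<le> 2"
  shows "\<exists>C. linear_cover C \<and> (\<Union>p\<in>C. path_edges p) = F \<and> card C + card F = card V"
proof -
  have "finite F" using assms finite_E finite_subset by blast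
  from this assms show ?thesis
  proof (induction F rule: finite_induct)
    case empty
    have "card ((\<lambda>v. [v]) ` V) = card V" by (intro card_image) (auto simp: inj_on_def)
    then show ?case using finite_V
      by (intro exI[of _ "(\<lambda>v. [v]) ` V"]) (auto simp: linear_cover_def)
  next
    case (insert e F)
    have deg: "edge_degree F w \<le> 2" if "w \<in> V" for w
      using insert(5)[OF that] insert(1,2) by (simp add: edge_degree_insert)
    then obtain C where C: "linear_cover C" and CF: "(\<Union>p\<in>C. path_edges p) = F"
      and cardC: "card C + card F = card V"
      using insert by auto
    have "card e = 2" using insert card_edge by auto
    then obtain u v where e: "e = {u, v}" "u \<noteq> v" by (auto simp: card_2_iff)
    have uv: "u \<in> V" "v \<in> V" using edge_subset[of e] insert e by auto
    have end_vertex: "w = hd p \<or> w = last p" if "p \<in> C" "w \<in> set p" "w \<in> e" for w p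
    proof (rule path_end_if_edge_degree_le_1)
      have "w \<in> V" using that uv e by auto
      have "edge_degree (path_edges p) w \<le> edge_degree F w"
        using CF that insert(1) by (intro edge_degree_mono) auto
      \<comment> \<open>The new edge \<open>e\<close> takes up one of the two places at
        \<open>w\<close>.\<close>
      also have "\<dots> \<le> 1"
        using insert(5)[OF \<open>w \<in> V\<close>] insert(1,2) that by (simp add: edge_degree_insert)
      finally show "edge_degree (path_edges p) w \<le> 1" .
    qed (use that C in \<open>auto simp: linear_cover_def\<close>)
    obtain p q where p: "p \<in> C" "u \<in> set p" and q: "q \<in> C" "v \<in> set q"
      using C uv unfolding linear_cover_def by blast
    have pq_E: "distinct p" "p \<noteq> []" "path_edges p \<subseteq> E" "distinct q" "q \<noteq> []" "path_edges q \<subseteq> E"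
      using C p q by (auto simp: linear_cover_def)
    have u_end: "u = hd p \<or> u = last p" and v_end: "v = hd q \<or> v = last q"
      using end_vertex p q e by auto
    \<comment> \<open>A single path would join the ends of \<open>e\<close> without using
      \<open>e\<close>.\<close>
    have "p \<noteq> q"
    proof
      assume "p = q"
      then have "{hd p, last p} = e" using u_end v_end e by auto
      moreover have "path_edges p \<subseteq> F" using CF p by auto
      ultimately show False using path_ends_not_edge[of p] pq_E insert by auto
    qed
    then have disj: "set p \<inter> set q = {}" using C p q unfolding linear_cover_def by blast
    obtain r where r: "distinct r" "r \<noteq> []" "set r = set p \<union> set q"
      "path_edges r = insert e (path_edges p \<union> path_edges q)"
      using path_join[OF pq_E(1,4,2,5) disj u_end v_end] e by metis
    define D where "D = insert r (C - {p, q})"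
    \<comment> \<open>That \<open>r\<close> is new ensures that \<open>D\<close> has exactly one
      path fewer than \<open>C\<close>.\<close>
    have r_notin: "r \<notin> C - {p, q}"
    proof
      assume "r \<in> C - {p, q}"
      then have "set r \<inter> set p = {}" using C p unfolding linear_cover_def by blast
      then show False using r p by auto
    qed
    have "C = insert p (insert q (C - {p, q}))" using p q by auto
    then have "(\<Union>p\<in>C. path_edges p) =
        path_edges p \<union> path_edges q \<union> (\<Union>p\<in>C - {p, q}. path_edges p)"
      "(\<Union>p\<in>C. set p) = set p \<union> set q \<union> (\<Union>p\<in>C - {p, q}. set p)"
      by blast+
    then have D_edges: "(\<Union>p\<in>D. path_edges p) = insert e F"
      and D_verts: "(\<Union>p\<in>D. set p) = V"
      using r CF C unfolding D_def linear_cover_def by auto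
    have "set r \<inter> set s = {}" if "s \<in> C - {p, q}" for s
    proof -
      have "set s \<inter> set p = {}" "set s \<inter> set q = {}"
        using C p q that unfolding linear_cover_def by blast+
      then show ?thesis using r by auto
    qed
    then have D_disj: "\<forall>s\<in>D. \<forall>t\<in>D. s \<noteq> t \<longrightarrow> set s \<inter> set t = {}"
      using C unfolding D_def linear_cover_def by blast
    have "finite C" using C by (simp add: linear_cover_def)
    have "path_edges s \<subseteq> E" if "s \<in> D" for s using D_edges that insert(4) by blast
    then have "linear_cover D"
      using C D_disj D_verts r by (auto simp: linear_cover_def D_def)
    moreover have "card D + card (insert e F) = card V"
    proof -
      have "card (C - {p, q}) + 2 = card C"
        using \<open>finite C\<close> p q \<open>p \<noteq> q\<close> card_mono[of C "{p, q}"] by (simp add: card_Diff_subset)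
      then show ?thesis
        using r_notin \<open>finite C\<close> insert(1,2) cardC by (simp add: D_def)
    qed
    ultimately show ?case using D_edges by blast
  qed
qed

text \<open>By disjointness, all edges of the cover at a given vertex come from one path. Each path
  has one vertex more than it has edges, and both counts can be summed over the cover.\<close>

lemma edges_of_linear_cover:
  assumes "linear_cover C"
  shows "\<exists>F \<subseteq> E. (\<forall>v\<in>V. edge_degree F v \<le> 2) \<and> card C + card F = card V"
proof (intro exI[of _ "\<Union>p\<in>C. path_edges p"] conjI ballI)
  let ?F = "\<Union>p\<in>C. path_edges p"
  show "?F \<subseteq> E" using assms by (auto simp: linear_cover_def)
  have fin: "finite C" and disj: "\<And>p q. p \<in> C \<Longrightarrow> q \<in> C \<Longrightarrow> p \<noteq> q \<Longrightarrow> set p \<inter> set q = {}"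
    and dist: "\<And>p. p \<in> C \<Longrightarrow> distinct p" and ne: "\<And>p. p \<in> C \<Longrightarrow> p \<noteq> []"
    and cov: "(\<Union>p\<in>C. set p) = V"
    using assms by (auto simp: linear_cover_def)
  show "edge_degree ?F v \<le> 2" if v: "v \<in> V" for v
  proof -
    obtain p where p: "p \<in> C" "v \<in> set p" using cov v by auto
    have "{e \<in> ?F. v \<in> e} = {e \<in> path_edges p. v \<in> e}"
      using p disj path_edges_subset by fastforce
    then have "edge_degree ?F v = edge_degree (path_edges p) v" by (simp add: edge_degree_def)
    also have "\<dots> \<le> 2" using edge_degree_path_edges_le[OF dist[OF p(1)], of v]
      by (auto split: if_splits)
    finally show ?thesis .
  qed
  have "card ?F = (\<Sum>p\<in>C. card (path_edges p))"
  proof (intro card_UN_disjoint fin ballI impI finite_path_edges)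
    fix p q assume "p \<in> C" "q \<in> C" "p \<noteq> q"
    then have "set p \<inter> set q = {}" by (rule disj)
    then show "path_edges p \<inter> path_edges q = {}"
      using path_edges_subset path_edges_nonempty by blast
  qed
  then have "card C + card ?F = (\<Sum>p\<in>C. 1 + card (path_edges p))"
    by (simp only: sum.distrib card_eq_sum)
  also have "\<dots> = (\<Sum>p\<in>C. card (set p))"
    using dist ne by (intro sum.cong) (auto simp: card_path_edges distinct_card Suc_leI)
  also have "\<dots> = card V"
    unfolding cov[symmetric] using disj fin by (intro card_UN_disjoint[symmetric]) auto
  finally show "card C + card ?F = card V" .
qed

end

section \<open>Counting edges at the heavy vertices of a tree\<close>

text \<open>For an acyclic edge set \<open>card_E\<close> amounts to connectedness;
  \<open>edge_degree_pos\<close> excludes the tree with a single vertex.\<close>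

locale tree_edges = acyclic_edges +
  assumes card_E: "card E + 1 = card V"
    and edge_degree_pos: "v \<in> V \<Longrightarrow> edge_degree E v > 0"
begin

definition heavy_V :: "'a set" where
  "heavy_V = {v \<in> V. edge_degree E v > 2}"

definition heavy_E :: "'a set set" where
  "heavy_E = {e \<in> E. e \<subseteq> heavy_V}"

lemma finite_heavy_V: "finite heavy_V" and finite_heavy_E: "finite heavy_E"
  using finite_V finite_E by (auto simp: heavy_V_def heavy_E_def)

text \<open>By the handshake identity, degree minus 2 sums to -2 over all vertices; each leaf
  contributes -1 and each vertex of degree 2 contributes 0. The form avoids subtraction of natural
  numbers.\<close>

lemma edge_degree_sum_heavy:
  "(\<Sum>v\<in>heavy_V. edge_degree E v) + 2 = card {v \<in> V. edge_degree E v = 1} + 2 * card heavy_V"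
proof -
  let ?L = "{v \<in> V. edge_degree E v = 1}" and ?M = "{v \<in> V. edge_degree E v = 2}"
  have "(\<Sum>v\<in>V. edge_degree E v) = (\<Sum>e\<in>E. card (e \<inter> V))"
    by (rule sum_edge_degree[OF finite_E finite_V])
  also have "\<dots> = (\<Sum>e\<in>E. 2)"
    using edge_subset card_edge by (intro sum.cong) (auto simp: Int_absorb2)
  finally have tot: "(\<Sum>v\<in>V. edge_degree E v) + 2 = 2 * card V" using card_E by simp
  have V: "V = ?L \<union> ?M \<union> heavy_V"
  proof -
    have "v \<in> ?L \<union> ?M \<union> heavy_V" if "v \<in> V" for v
      using edge_degree_pos[OF that] that by (auto simp: heavy_V_def)
    then show ?thesis by (auto simp: heavy_V_def)
  qed
  have fin: "finite ?L" "finite ?M" using finite_V by auto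
  have dj: "?L \<inter> ?M = {}" "(?L \<union> ?M) \<inter> heavy_V = {}" by (auto simp: heavy_V_def)
  have "(\<Sum>v\<in>V. edge_degree E v) = (\<Sum>v\<in>?L \<union> ?M \<union> heavy_V. edge_degree E v)" using V by simp
  also have "\<dots> = card ?L + 2 * card ?M + (\<Sum>v\<in>heavy_V. edge_degree E v)"
    using fin finite_heavy_V dj by (simp add: sum.union_disjoint)
  finally have s: "(\<Sum>v\<in>V. edge_degree E v) = card ?L + 2 * card ?M + (\<Sum>v\<in>heavy_V. edge_degree E v)" .
  have "card V = card (?L \<union> ?M \<union> heavy_V)" using V by simp
  also have "\<dots> = card ?L + card ?M + card heavy_V"
    using fin finite_heavy_V dj by (simp add: card_Un_disjoint)
  finally show ?thesis using s tot by linarith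
qed

lemma card_edge_Int_heavy_V_le:
  assumes "e \<in> E"
  shows "card (e \<inter> heavy_V) \<le> 1 + (if e \<in> heavy_E then 1 else 0)"
proof (cases "e \<subseteq> heavy_V")
  case True
  then show ?thesis using assms card_edge by (auto simp: heavy_E_def Int_absorb2)
next
  case False
  then have "card (e \<inter> heavy_V) < card e"
    using assms card_edge[of e] by (intro psubset_card_mono) (auto intro: card_ge_0_finite)
  then show ?thesis using card_edge[OF assms] by simp
qed

text \<open>Once an edge has a heavy end, the preceding estimate is exact; this is what makes the
  count for the constructed edge set an equality.\<close>

lemma card_edge_Int_heavy_V_eq:
  assumes "e \<in> E" "e \<inter> heavy_V \<noteq> {}"
  shows "card (e \<inter> heavy_V) = 1 + (if e \<in> heavy_E then 1 else 0)"
proof (cases "e \<subseteq> heavy_V")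
  case True
  then show ?thesis using assms card_edge by (auto simp: heavy_E_def Int_absorb2)
next
  case False
  then have "e \<notin> heavy_E" by (auto simp: heavy_E_def)
  moreover have "card (e \<inter> heavy_V) > 0" using assms finite_heavy_V by (simp add: card_gt_0_iff)
  ultimately show ?thesis using card_edge_Int_heavy_V_le[OF assms(1)] by simp
qed

lemma sum_one_plus_heavy:
  assumes "R \<subseteq> E"
  shows "(\<Sum>e\<in>R. 1 + (if e \<in> heavy_E then 1 else 0)) = card R + card (R \<inter> heavy_E)"
proof -
  have "finite R" using assms finite_E finite_subset by blast
  then show ?thesis by (simp only: sum.distrib sum.If_cases card_eq_sum) (simp add: Int_def)
qed

text \<open>The degrees of the removed edges at heavy vertices sum to at least the total excess over
  2, and to at most the number of removed edges plus that of removed heavy edges. The second claim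
  is the case of equality.\<close>

lemma card_removed_edges:
  assumes "F \<subseteq> E" "\<And>v. v \<in> V \<Longrightarrow> edge_degree F v \<le> 2"
  shows "card {v \<in> V. edge_degree E v = 1} + card F \<le> card V + card heavy_E + 1" (is ?le)
    and "card {v \<in> V. edge_degree E v = 1} + card F = card V + card heavy_E + 1 \<Longrightarrow>
      v \<in> heavy_V \<Longrightarrow> edge_degree (E - heavy_E) v \<ge> 2"
proof -
  let ?R = "E - F"
  have fin: "finite F" "finite ?R" using assms finite_E finite_subset by blast+
  have cards: "card ?R + card F + 1 = card V"
    using card_E assms(1) fin card_mono[OF finite_E assms(1)] by (simp add: card_Diff_subset)
  have deg: "edge_degree ?R v + edge_degree F v = edge_degree E v" for v
    by (rule edge_degree_Diff[OF finite_E assms(1)])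
  have FH: "edge_degree F v \<le> 2" if "v \<in> heavy_V" for v using assms(2) that by (auto simp: heavy_V_def)
  have "(\<Sum>v\<in>heavy_V. edge_degree ?R v) = (\<Sum>e\<in>?R. card (e \<inter> heavy_V))"
    by (rule sum_edge_degree[OF fin(2) finite_heavy_V])
  also have "\<dots> \<le> (\<Sum>e\<in>?R. 1 + (if e \<in> heavy_E then 1 else 0))"
    by (intro sum_mono card_edge_Int_heavy_V_le) auto
  also have "\<dots> = card ?R + card (?R \<inter> heavy_E)" by (rule sum_one_plus_heavy) auto
  finally have upper: "(\<Sum>v\<in>heavy_V. edge_degree ?R v) \<le> card ?R + card (?R \<inter> heavy_E)" .
  have le_h: "card (?R \<inter> heavy_E) \<le> card heavy_E" using finite_heavy_E by (intro card_mono) auto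
  have sum_deg: "(\<Sum>v\<in>heavy_V. edge_degree ?R v) + (\<Sum>v\<in>heavy_V. edge_degree F v) = (\<Sum>v\<in>heavy_V. edge_degree E v)"
    by (simp add: sum.distrib[symmetric] deg)
  have FH_sum: "(\<Sum>v\<in>heavy_V. edge_degree F v) \<le> (\<Sum>v\<in>heavy_V. 2)" by (intro sum_mono FH)
  show ?le using upper le_h sum_deg FH_sum edge_degree_sum_heavy cards by simp
  assume eq: "card {v \<in> V. edge_degree E v = 1} + card F = card V + card heavy_E + 1"
    and v: "v \<in> heavy_V"
  \<comment> \<open>Equality in the total forces the individual estimates to be tight.\<close>
  have "card (?R \<inter> heavy_E) = card heavy_E" and sum_eq: "(\<Sum>v\<in>heavy_V. edge_degree F v) = (\<Sum>v\<in>heavy_V. 2)"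
    using eq upper le_h sum_deg FH_sum edge_degree_sum_heavy cards by simp_all
  then have "?R \<inter> heavy_E = heavy_E" using finite_heavy_E by (intro card_subset_eq) auto
  then have "F \<subseteq> E - heavy_E" using assms(1) by auto
  \<comment> \<open>Termwise bounds with equal sums agree term by term.\<close>
  have "edge_degree F v = 2"
    using sum_mono_inv[OF sum_eq FH v finite_heavy_V] .
  then show "edge_degree (E - heavy_E) v \<ge> 2"
    using edge_degree_mono[OF \<open>F \<subseteq> E - heavy_E\<close>, of v] finite_E by simp
qed

text \<open>Each heavy vertex chooses two of its edges that are not heavy and rejects its other
  edges. Then all estimates in the count of removed edges become equalities.\<close>

lemma ex_sparse_edges:
  assumes "\<And>v. v \<in> heavy_V \<Longrightarrow> edge_degree (E - heavy_E) v \<ge> 2"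
  shows "\<exists>F \<subseteq> E. (\<forall>v\<in>V. edge_degree F v \<le> 2) \<and>
    card {v \<in> V. edge_degree E v = 1} + card F = card V + card heavy_E + 1"
proof -
  have "\<exists>S. S \<subseteq> {e \<in> E - heavy_E. v \<in> e} \<and> card S = 2" if "v \<in> heavy_V" for v
    using assms[OF that] unfolding edge_degree_def by (meson obtain_subset_with_card_n)
  then obtain S where S: "\<And>v. v \<in> heavy_V \<Longrightarrow> S v \<subseteq> {e \<in> E - heavy_E. v \<in> e}"
    "\<And>v. v \<in> heavy_V \<Longrightarrow> card (S v) = 2"
    by metis
  \<comment> \<open>An edge is kept if all its heavy ends have chosen it; edges without heavy ends
    are kept vacuously.\<close>
  define F where "F = {e \<in> E. \<forall>v\<in>heavy_V \<inter> e. e \<in> S v}"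
  have F: "F \<subseteq> E" by (auto simp: F_def)
  let ?R = "E - F"
  have fin: "finite F" "finite ?R" using F finite_E finite_subset by blast+
  have heavy_eq: "edge_degree F v = 2" if v: "v \<in> heavy_V" for v
  proof -
    have "{e \<in> F. v \<in> e} = S v"
    proof (intro equalityI subsetI)
      fix e assume e: "e \<in> S v"
      then have eE: "e \<in> E" "e \<notin> heavy_E" "v \<in> e" using S(1)[OF v] by auto
      \<comment> \<open>As \<open>e\<close> is not a heavy edge, \<open>v\<close> is its only heavy
        end, and the choice at \<open>v\<close> alone decides.\<close>
      have "card (e \<inter> heavy_V) = 1" using card_edge_Int_heavy_V_eq[OF eE(1)] eE v by auto
      then have "e \<inter> heavy_V = {v}" using eE v by (metis IntI card_1_singletonE singletonD)
      then show "e \<in> {e \<in> F. v \<in> e}" using eE e by (auto simp: F_def)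
    qed (use v in \<open>auto simp: F_def\<close>)
    then show ?thesis using S(2)[OF v] by (simp add: edge_degree_def)
  qed
  have "edge_degree F v \<le> 2" if "v \<in> V" for v
  proof (cases "v \<in> heavy_V")
    case False
    then show ?thesis using edge_degree_mono[OF F finite_E, of v] that by (auto simp: heavy_V_def)
  qed (simp add: heavy_eq)
  moreover have "card {v \<in> V. edge_degree E v = 1} + card F = card V + card heavy_E + 1"
  proof -
    have cards: "card ?R + card F + 1 = card V"
      using card_E F fin card_mono[OF finite_E F] by (simp add: card_Diff_subset)
    have deg: "edge_degree ?R v + edge_degree F v = edge_degree E v" for v
      by (rule edge_degree_Diff[OF finite_E F])
    have "e \<notin> F" if "e \<in> heavy_E" for e
    proof
      assume "e \<in> F"
      have "e \<noteq> {}" using that card_edge[of e] by (auto simp: heavy_E_def)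
      then obtain v where "v \<in> e" by auto
      then have "v \<in> heavy_V" using that by (auto simp: heavy_E_def)
      then show False using S(1)[of v] \<open>e \<in> F\<close> \<open>v \<in> e\<close> that by (auto simp: F_def)
    qed
    then have hR: "?R \<inter> heavy_E = heavy_E" by (auto simp: heavy_E_def)
    have "(\<Sum>v\<in>heavy_V. edge_degree ?R v) = (\<Sum>e\<in>?R. card (e \<inter> heavy_V))"
      by (rule sum_edge_degree[OF fin(2) finite_heavy_V])
    \<comment> \<open>A removed edge was rejected by a heavy end, so it meets
      \<open>heavy_V\<close>.\<close>
    also have "\<dots> = (\<Sum>e\<in>?R. 1 + (if e \<in> heavy_E then 1 else 0))"
      by (intro sum.cong card_edge_Int_heavy_V_eq) (auto simp: F_def)
    also have "\<dots> = card ?R + card heavy_E" by (subst sum_one_plus_heavy) (auto simp: hR)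
    finally have R_sum: "(\<Sum>v\<in>heavy_V. edge_degree ?R v) = card ?R + card heavy_E" .
    have "(\<Sum>v\<in>heavy_V. edge_degree ?R v) + (\<Sum>v\<in>heavy_V. edge_degree F v) = (\<Sum>v\<in>heavy_V. edge_degree E v)"
      by (simp add: sum.distrib[symmetric] deg)
    then show ?thesis using R_sum heavy_eq edge_degree_sum_heavy cards by simp
  qed
  ultimately show ?thesis using F by blast
qed

lemma ex_linear_cover: "\<exists>C. linear_cover C"
  using linear_cover_of_edges[of "{}"] by (auto simp: edge_degree_def)

text \<open>The edge set \<open>F\<close> of a minimum cover serves both directions: the bound on
  \<open>card F\<close> bounds the minimum from below, and the case of equality for \<open>F\<close>
  gives the converse.\<close>

lemma sparse_iff_least_linear_cover:
  "(\<forall>v\<in>heavy_V. edge_degree (E - heavy_E) v \<ge> 2) \<longleftrightarrow>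
    int (LEAST k. \<exists>C. linear_cover C \<and> card C = k) =
    int (card {v \<in> V. edge_degree E v = 1}) - int (card heavy_E) - 1"
    (is "?sparse \<longleftrightarrow> int ?P = int ?l - int ?h - 1")
proof -
  obtain C where C: "linear_cover C" "card C = ?P"
    using LeastI_ex[of "\<lambda>k. \<exists>C. linear_cover C \<and> card C = k"] ex_linear_cover by blast
  then obtain F where F: "F \<subseteq> E" "\<forall>v\<in>V. edge_degree F v \<le> 2" "?P + card F = card V"
    using edges_of_linear_cover[of C] by metis
  show ?thesis
  proof
    assume ?sparse
    then obtain F' where F': "F' \<subseteq> E" "\<And>v. v \<in> V \<Longrightarrow> edge_degree F' v \<le> 2"
      "?l + card F' = card V + ?h + 1"
      using ex_sparse_edges by blast
    then obtain D where D: "linear_cover D" "card D + card F' = card V"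
      using linear_cover_of_edges by blast
    have "?P \<le> card D" using D(1) by (intro Least_le) auto
    moreover have "?l + card F \<le> card V + ?h + 1" using card_removed_edges(1) F by blast
    ultimately show "int ?P = int ?l - int ?h - 1" using D(2) F'(3) F(3) by linarith
  next
    assume "int ?P = int ?l - int ?h - 1"
    then have "?l + card F = card V + ?h + 1" using F(3) by linarith
    then show ?sparse using card_removed_edges(2) F by blast
  qed
qed

end

section \<open>From symmetric digraphs to sets of unordered edges\<close>

definition edges :: "'a pair_pre_digraph \<Rightarrow> 'a set set" where
  "edges G = {{u, v} |u v. (u, v) \<in> parcs G}"

context pair_graph
begin

lemma doubleton_mem_edges: "{u, v} \<in> edges G \<longleftrightarrow> (u, v) \<in> parcs G"
proof -
  have "(v, u) \<in> parcs G \<Longrightarrow> (u, v) \<in> parcs G" for u v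
    using pair_sym_arcs by (auto simp: symmetric_def sym_def)
  then show ?thesis by (auto simp: edges_def doubleton_eq_iff)
qed

lemma path_edges_subset_edges: "path_edges p \<subseteq> edges G \<longleftrightarrow> set (vwalk_arcs p) \<subseteq> parcs G"
  by (induction p rule: path_edges.induct) (auto simp: doubleton_mem_edges)

lemma vpath_iff:
  "vpath p (with_proj G) \<longleftrightarrow> p \<noteq> [] \<and> distinct p \<and> set p \<subseteq> pverts G \<and> path_edges p \<subseteq> edges G"
  by (auto simp: vpath_def vwalk_def path_edges_subset_edges)

text \<open>With \<open>w = hd p\<close> this is the closed walk, with its vertex list, from which a
  cycle is obtained.\<close>

lemma vwalk_arcs_closing:
  "p \<noteq> [] \<Longrightarrow> pcas (hd p) (vwalk_arcs p @ [(last p, w)]) w \<and>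
     pawalk_verts (hd p) (vwalk_arcs p @ [(last p, w)]) = p @ [w]"
  by (induction p rule: vwalk_arcs.induct) auto

lemma acyclic_graphD:
  assumes "acyclic_graph G" "distinct p" "length p \<ge> 3" "path_edges p \<subseteq> edges G"
  shows "{hd p, last p} \<notin> edges G"
proof
  assume "{hd p, last p} \<in> edges G"
  then have arc: "(last p, hd p) \<in> parcs G" by (metis doubleton_mem_edges insert_commute)
  let ?c = "vwalk_arcs p @ [(last p, hd p)]"
  have "p \<noteq> []" using assms(3) by auto
  \<comment> \<open>A path has one arc fewer than vertices, so with the closing arc the cycle has
    exactly \<open>length p\<close> arcs.\<close>
  have "length (vwalk_arcs p) = length p - 1" using vwalk_length_simp[of p]
    by (simp only: vwalk_length_def)
  then have "length ?c \<ge> 3" using assms(3) by simp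
  moreover have "cycle ?c"
    unfolding cycle_def awalk_def
    using vwalk_arcs_closing[OF \<open>p \<noteq> []\<close>, of "hd p"] arc assms(2,4) \<open>p \<noteq> []\<close> in_arcsD2[OF arc]
    by (intro exI[of _ "hd p"]) (auto simp: path_edges_subset_edges neq_Nil_conv)
  ultimately show False using assms(1) by (auto simp: acyclic_graph_def)
qed

lemma card_edges: "e \<in> edges G \<Longrightarrow> card e = 2"
  using no_loops' by (fastforce simp: edges_def card_2_iff)

lemma degree_eq_edge_degree: "degree G v = edge_degree (edges G) v"
proof -
  have "out_arcs (with_proj G) v = Pair v ` {w. w \<noteq> v \<and> (v, w) \<in> parcs G}"
    using no_loops' by (fastforce simp: out_arcs_def)
  then have "degree G v = card {w. w \<noteq> v \<and> (v, w) \<in> parcs G}"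
    by (simp add: degree_def out_degree_def card_image inj_on_def)
  then show ?thesis
    by (simp add: edge_degree_eq_card_neighbours card_edges doubleton_mem_edges)
qed

end

text \<open>Connectedness makes the component labelling constant, and a single label gives
  \<open>card_E\<close>. A second vertex guarantees an edge at every vertex.\<close>

lemma tree_graph_tree_edges:
  assumes "tree_graph T" "card (pverts T) \<ge> 2"
  shows "tree_edges (pverts T) (edges T)"
proof -
  interpret pair_graph T using assms by (simp add: tree_graph_def)
  have acyc: "acyclic_graph T" using assms by (simp add: tree_graph_def)
  interpret acyclic_edges "pverts T" "edges T"
  proof
    show "e \<subseteq> pverts T" if "e \<in> edges T" for e
      using that in_arcsD1 in_arcsD2 by (auto simp: edges_def)
  qed (use acyclic_graphD[OF acyc] card_edges pair_finite_verts in auto)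
  \<comment> \<open>Connectedness is defined through the symmetric closure, which does not change
    reachability here because the arcs are already symmetric.\<close>
  have reach: "u \<rightarrow>\<^sup>*\<^bsub>with_proj T\<^esub> v" if "u \<in> pverts T" "v \<in> pverts T" for u v
  proof -
    have "u \<rightarrow>\<^sup>*\<^bsub>with_proj (mk_symmetric (with_proj T))\<^esub> v"
      using assms(1) that
      by (auto simp: tree_graph_def connected_def strongly_connected_def)
    then show ?thesis using reachable_mk_symmetric_eq[OF sym_arcs] by simp
  qed
  have "edge_degree (edges T) v > 0" if v: "v \<in> pverts T" for v
  proof -
    obtain w where w: "w \<in> pverts T" "w \<noteq> v"
      using assms(2) by (metis card_2_iff' card_le_Suc0_iff_eq pair_finite_verts not_less_eq_eq numeral_2_eq_2 v)
    \<comment> \<open>This is the first arc of a walk from \<open>v\<close> to the other vertex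
      \<open>w\<close>.\<close>
    then obtain x where "(v, x) \<in> parcs T"
      using reach[OF v w(1)] by (auto elim: converse_reachable_cases)
    then have "{v, x} \<in> {e \<in> edges T. v \<in> e}" by (simp add: doubleton_mem_edges)
    then show ?thesis using finite_E unfolding edge_degree_def by (auto simp: card_gt_0_iff)
  qed
  moreover have "card (edges T) + 1 = card (pverts T)"
  proof -
    obtain c :: "'a \<Rightarrow> 'a" where c: "\<And>x y. {x, y} \<in> edges T \<Longrightarrow> c x = c y"
      "card (c ` pverts T) + card (edges T) = card (pverts T)"
      using component_labelling[of "edges T"] by blast
    have const: "c u = c v" if "u \<in> pverts T" "v \<in> pverts T" for u v
      using reach[OF that]
    proof (induction rule: reachable_induct)
      case (step x y)
      then show ?case using c(1)[of x y] by (simp add: doubleton_mem_edges)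
    qed simp
    obtain r where r: "r \<in> pverts T" using assms(2) by fastforce
    have "c ` pverts T = {c r}" using const r by blast
    then show ?thesis using c(2) by simp
  qed
  ultimately show ?thesis by unfold_locales auto
qed

theorem theorem14:
  fixes T :: "'a pair_pre_digraph" and l h :: nat
  assumes "tree_graph T"
    and "l = card (leaves T)" and "l \<ge> 2"
    and "h = card (heavy_edges T)"
  shows "general_2_sparse T \<longleftrightarrow> int (path_covering_number T) = int l - int h - 1"
proof -
  interpret pair_graph T using assms by (simp add: tree_graph_def)
  have "leaves T \<subseteq> pverts T" by (auto simp: leaves_def)
  then have "card (pverts T) \<ge> 2"
    using assms(2,3) card_mono[OF pair_finite_verts, of "leaves T"] by linarith
  then interpret tree_edges "pverts T" "edges T"
    using tree_graph_tree_edges assms(1) by blast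
  have heavy_iff: "heavy T v \<longleftrightarrow> v \<in> heavy_V" for v
    by (auto simp: heavy_def heavy_V_def degree_eq_edge_degree)
  have l_eq: "l = card {v \<in> pverts T. edge_degree (edges T) v = 1}"
    using assms(2) by (simp add: leaves_def degree_eq_edge_degree)
  have "heavy_edges T = {e \<in> edges T. e \<subseteq> heavy_V}"
    unfolding heavy_edges_def heavy_iff by (auto simp: edges_def)
  then have h_eq: "h = card heavy_E" using assms(4) by (simp add: heavy_E_def)
  \<comment> \<open>At a heavy vertex \<open>v\<close>, an edge is heavy exactly if its other end
    is, so light neighbours correspond to the edges at \<open>v\<close> outside
    \<open>heavy_E\<close>.\<close>
  have "card (light_neighbors T v) = edge_degree (edges T - heavy_E) v" if "v \<in> heavy_V" for v
  proof -
    have "light_neighbors T v = {w. w \<noteq> v \<and> {v, w} \<in> edges T - heavy_E}"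
      using that no_loops' in_arcsD2
      by (auto simp: light_neighbors_def light_def heavy_iff heavy_E_def doubleton_mem_edges)
    then show ?thesis
      by (subst edge_degree_eq_card_neighbours) (auto simp: card_edges)
  qed
  then have sparse: "general_2_sparse T \<longleftrightarrow> (\<forall>v\<in>heavy_V. edge_degree (edges T - heavy_E) v \<ge> 2)"
    by (auto simp: general_2_sparse_def heavy_iff heavy_V_def)
  have "path_covering T C \<longleftrightarrow> linear_cover C" for C
    by (auto simp: path_covering_def linear_cover_def vpath_iff)
  then have "path_covering_number T = (LEAST k. \<exists>C. linear_cover C \<and> card C = k)"
    by (simp add: path_covering_number_def)
  then show ?thesis
    unfolding sparse l_eq h_eq by (simp add: sparse_iff_least_linear_cover)
qed

end
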